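(* (Impact of return costs on prices with observable prices.) Let $s\in(0,\tfrac18)$, $a=1-\sqrt{2s}\in(\tfrac12,1)$, $\bar r_p(a)=(1-a)^2$, $\bar r(a)=3-2\sqrt{-a^2+2a+1}$, and for $r\in[0,1-a]$ let $(p_1^*,p_2^* )$ be the equilibrium prices. 1. There exists $\hat r(a)$ with $\bar r_p(a)<\hat r(a)<\bar r(a)$ such that for $r\in[0,\hat r(a)]$ (within $[0,1-a]$), both equilibrium prices $p_1^*$ and $p_2^*$ strictly decrease as $r$ increases. 2. For $\bar r(a)<r\le1-a$, $p_1^*$ strictly decreases and $p_2^*$ strictly increases as $r$ increases.
   Context: Two firms sell one product each at zero marginal cost. Consumers (unit mass) have match values $u_1,u_2$, i.i.d. uniform on $[0,1]$. Firm 1 is prominent (searched and bought first, at no search cost); searching and buying product 2 costs $s$; returned units are fully refunded and cost the firm $r$ each. Both prices are observable before searching, so a consumer buys product 2 iff $u_1<a+p_1-p_2$. With $$d_1^n=1-a+p_2-p_1,\quad k_1=\tfrac12(a^2-p_2^2),\quad d_2^r=(a-p_2+p_1)(1-a),\quad k_2=\tfrac{a^2-p_2^2}{2}+(p_1-p_2)(a-p_2),$$ the profits are $$\pi_1(p_1,p_2)=(p_1+r)(d_1^n+k_1)-r,\qquad \pi_2(p_1,p_2)=(p_2+r)(d_2^r+k_2)-r(1-d_1^n).$$ An equilibrium is a pair $(p_1^*,p_2^* )$ such that $p_1^*$ maximizes $\pi_1(\cdot,p_2^* )$ over $p_1\ge0$ and $p_2^*$ maximizes $\pi_2(p_1^*,\cdot)$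 over $p_2\in[0,a]$. For $r\in[0,1-a]$ the paper shows that the equilibrium exists and is unique. *)

theory Defs
  imports Complex_Main
begin

text \<open>\<open>d1n\<close>: consumers who keep product 1 without buying product 2. Every buyer of product 2 already
  bought product 1: \<open>k1\<close> counts those who then keep product 1, \<open>d2r\<close> those who keep product 2
  with \<open>u2 \<ge> a\<close>, and \<open>k2\<close> those who keep product 2 with \<open>u2 < a\<close>. The closed forms are used
  for every price pair.\<close>

definition d1n :: "real \<Rightarrow> real \<Rightarrow> real \<Rightarrow> real" where
  "d1n a p1 p2 = 1 - a + p2 - p1"

definition k1 :: "real \<Rightarrow> real \<Rightarrow> real" where
  "k1 a p2 = (1/2) * (a^2 - p2^2)"

definition d2r :: "real \<Rightarrow> real \<Rightarrow> real \<Rightarrow> real" where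
  "d2r a p1 p2 = (a - p2 + p1) * (1 - a)"

definition k2 :: "real \<Rightarrow> real \<Rightarrow> real \<Rightarrow> real" where
  "k2 a p1 p2 = (a^2 - p2^2) / 2 + (p1 - p2) * (a - p2)"

definition profit1 :: "real \<Rightarrow> real \<Rightarrow> real \<Rightarrow> real \<Rightarrow> real" where
  "profit1 a r p1 p2 = (p1 + r) * (d1n a p1 p2 + k1 a p2) - r"

definition profit2 :: "real \<Rightarrow> real \<Rightarrow> real \<Rightarrow> real \<Rightarrow> real" where
  "profit2 a r p1 p2 = (p2 + r) * (d2r a p1 p2 + k2 a p1 p2) - r * (1 - d1n a p1 p2)"

definition is_equilibrium :: "real \<Rightarrow> real \<Rightarrow> real \<times> real \<Rightarrow> bool" where
  "is_equilibrium a r = (\<lambda>(p1, p2).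
     is_arg_max (\<lambda>q. profit1 a r q p2) (\<lambda>q. 0 \<le> q) p1 \<and>
     is_arg_max (\<lambda>q. profit2 a r p1 q) (\<lambda>q. 0 \<le> q \<and> q \<le> a) p2)"

text \<open>The equilibrium is unique for \<open>0 \<le> r \<le> 1 - a\<close> (with \<open>1/2 < a < 1\<close>);
  outside this range the value is not meaningful.\<close>

definition equilibrium :: "real \<Rightarrow> real \<Rightarrow> real \<times> real" where
  "equilibrium a r = (THE p. is_equilibrium a r p)"

definition price1 :: "real \<Rightarrow> real \<Rightarrow> real" where
  "price1 a r = fst (equilibrium a r)"

definition price2 :: "real \<Rightarrow> real \<Rightarrow> real" where
  "price2 a r = snd (equilibrium a r)"

definition rbar_p :: "real \<Rightarrow> real" where
  "rbar_p a = (1 - a)^2"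

definition rbar :: "real \<Rightarrow> real" where
  "rbar a = 3 - 2 * sqrt (- (a^2) + 2 * a + 1)"

end

theory Submission
  imports Defs
begin

text \<open>
  Firm 1's best reply \<open>reply1\<close> is an explicit quadratic in \<open>p2\<close>. Substituting it into firm 2's
  first-order condition turns an equilibrium into a root \<open>p2 \<in> (0, 1/2)\<close> of a cubic \<open>foc2\<close>, whose
  coefficients are quadratic in \<open>r\<close>. On \<open>[0, 1/2]\<close> the secant slopes of the cubic in \<open>p2\<close> are
  negative, so there is exactly one root, and its direction of change is the sign of the
  \<open>r\<close>-derivative of \<open>foc2\<close> at the root. The threshold \<open>rbar\<close> is the return cost at which the root
  equals \<open>(1 - r)/2\<close>; beyond it the root is larger and the \<open>r\<close>-derivative is positive. Up to
  \<open>(1 - a)^2 + 1/50\<close> the root is small enough for the \<open>r\<close>-derivative to be negative. Finally \<open>p2\<close>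
  always rises by less than \<open>r\<close>, which forces \<open>p1\<close> down.
\<close>

section \<open>Best reply of firm 1 and first-order condition of firm 2\<close>

definition reply1 :: "real \<Rightarrow> real \<Rightarrow> real \<Rightarrow> real" where
  "reply1 a r p2 = (1 - a - r + p2 + (a^2 - p2^2) / 2) / 2"

definition marginal2 :: "real \<Rightarrow> real \<Rightarrow> real \<Rightarrow> real \<Rightarrow> real" where
  "marginal2 a r p1 p2 = 3/2 * p2^2 - p2 * (2 + 2 * p1 - r) + a - a^2 / 2 + p1 * (1 - r)"

definition foc2 :: "real \<Rightarrow> real \<Rightarrow> real \<Rightarrow> real" where
  "foc2 a r p2 = marginal2 a r (reply1 a r p2) p2"

text \<open>The partial derivative of \<open>foc2\<close> in \<open>r\<close>.\<close>

definition foc2_dr :: "real \<Rightarrow> real \<Rightarrow> real \<Rightarrow> real" where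
  "foc2_dr a r p2 = p2^2 / 4 + 3/2 * p2 - 3/4 - (1 - a)^2 / 4 + r"

text \<open>Minus the secant slope of \<open>foc2\<close> in \<open>p2\<close> between
  \<open>y\<close> and \<open>z\<close>.\<close>

definition foc2_drop :: "real \<Rightarrow> real \<Rightarrow> real \<Rightarrow> real \<Rightarrow> real" where
  "foc2_drop a r y z =
     2 + (1 - a)^2 / 2 - (y^2 + y * z + z^2) / 2 - (y + z) / 4 - r * ((y + z) / 4 + 3/2)"

lemma profit1_reply1:
  "profit1 a r (reply1 a r p2) p2 - profit1 a r q p2 = (reply1 a r p2 - q)^2"
  unfolding profit1_def d1n_def k1_def reply1_def by (simp add: field_simps power2_eq_square)

text \<open>Exact Taylor expansion of a cubic; the sign of its remainder later turns the first-order
  condition into a global optimum.\<close>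

lemma profit2_expand:
  "profit2 a r p1 q - profit2 a r p1 p2 =
     marginal2 a r p1 p2 * (q - p2) + (q - p2)^2 / 2 * (2 * p2 + q - 2 * p1 - 2 + r)"
  unfolding profit2_def d1n_def d2r_def k2_def marginal2_def by (simp add: field_simps power2_eq_square)

lemma profit2_deriv:
  "((\<lambda>q. profit2 a r p1 q) has_real_derivative marginal2 a r p1 p2) (at p2)"
  unfolding profit2_def d1n_def d2r_def k2_def marginal2_def
  by (auto intro!: derivative_eq_intros simp: field_simps power2_eq_square)

lemma foc2_eq:
  "foc2 a r y = y^3 / 2 + y^2 / 4 - 2 * y - (1 - a)^2 * y / 2 + 3/4 - (1 - a)^2 / 4
     + r * (y^2 / 4 + 3/2 * y - 3/4 - (1 - a)^2 / 4) + r^2 / 2"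
  unfolding foc2_def marginal2_def reply1_def
  by (simp add: field_simps power2_eq_square power3_eq_cube)

lemma foc2_diff_price: "foc2 a r z - foc2 a r y = - (z - y) * foc2_drop a r y z"
  unfolding foc2_eq foc2_drop_def by (simp add: field_simps power2_eq_square power3_eq_cube)

text \<open>\<open>foc2\<close> is quadratic in \<open>r\<close>, so its secant slope is exactly the
  derivative at the midpoint.\<close>

lemma foc2_diff_cost: "foc2 a t y - foc2 a r y = (t - r) * foc2_dr a ((r + t) / 2) y"
  unfolding foc2_eq foc2_dr_def by (simp add: field_simps power2_eq_square power3_eq_cube)

lemma product_bounds_half:
  fixes y z :: real
  assumes "0 \<le> y" "y \<le> 1/2" "0 \<le> z" "z \<le> 1/2"
  shows "y * z \<le> 1/4"
  using mult_mono[of y "1/2" z "1/2"] assms by simp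

section \<open>Existence and uniqueness at a fixed return cost\<close>

context
  fixes a r :: real
  assumes a: "1/2 < a" "a < 1" and r: "0 \<le> r" "r \<le> 1 - a"
begin

lemma cost_sq: "r^2 \<le> (1 - a)^2" "(1 - a)^2 < 1/4"
proof -
  show "r^2 \<le> (1 - a)^2" using r by (intro power_mono) auto
  have "(1 - a)^2 < (1/2)^2" using a by (intro power_strict_mono) auto
  then show "(1 - a)^2 < 1/4" by (simp add: power2_eq_square)
qed

lemma reply1_pos:
  assumes "0 \<le> y" "y \<le> a"
  shows "0 < reply1 a r y"
proof -
  have "y^2 \<le> a^2" using assms by (intro power_mono) auto
  moreover have "y^2 < a^2" if "y = 0" using that a by simp
  ultimately show ?thesis using assms a r unfolding reply1_def by (cases "y = 0") argo+
qed

lemma foc2_drop_gt: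
  assumes "0 \<le> y" "y \<le> 1/2" "0 \<le> z" "z \<le> 1/2"
  shows "foc2_drop a r y z \<ge> 11/8 + (1 - a)^2 / 2 - 7/4 * r" "foc2_drop a r y z > 0"
proof -
  \<comment> \<open>The worst case is \<open>y = z = 1/2\<close>, where every subtracted term is
    largest.\<close>
  have "r * ((y + z) / 4 + 3/2) \<le> r * (7/4)"
    using assms r by (intro mult_left_mono) auto
  then show "foc2_drop a r y z \<ge> 11/8 + (1 - a)^2 / 2 - 7/4 * r"
    using assms product_bounds_half[OF assms(1,2,1,2)] product_bounds_half[OF assms]
      product_bounds_half[OF assms(3,4,3,4)]
    unfolding foc2_drop_def power2_eq_square[of y] power2_eq_square[of z]
    by (simp only: add_divide_distrib)
  moreover have "11/8 + (1 - a)^2 / 2 - 7/4 * r > 0"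
    using r a zero_le_power2[of "1 - a"] by argo
  ultimately show "foc2_drop a r y z > 0" by linarith
qed

lemma foc2_zero_pos: "foc2 a r 0 > 0"
proof -
  have "r * (3/4 + (1 - a)^2 / 4) \<le> (1/2) * (3/4 + (1 - a)^2 / 4)"
    using r a by (intro mult_right_mono) auto
  then have "r * (3/4 + (1 - a)^2 / 4) \<le> 1/2" using cost_sq(2) by argo
  moreover have "foc2 a r 0 = 3/4 - (1 - a)^2 / 4 - r * (3/4 + (1 - a)^2 / 4) + r^2 / 2"
    unfolding foc2_eq by (simp add: algebra_simps)
  ultimately show ?thesis using cost_sq(2) zero_le_power2[of r] by linarith
qed

lemma foc2_neg:
  assumes "1/2 \<le> y" "y \<le> a"
  shows "foc2 a r y < 0"
proof -
  \<comment> \<open>With \<open>r * y\<close> bounded this way, the terms free of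
    \<open>reply1\<close> factor. The first product is negative for \<open>y < a\<close>; at
    \<open>y = a\<close> it vanishes and the second gives strictness.\<close>
  have "r * y \<le> (1 - a) * y" using r assms by (intro mult_right_mono) auto
  then have "foc2 a r y \<le> (y - a) * (3 * y - 2 + a) / 2 - reply1 a r y * (2 * y + r - 1)"
    unfolding foc2_def marginal2_def by (simp add: field_simps power2_eq_square)
  moreover have "(y - a) * (3 * y - 2 + a) \<le> 0" "y < a \<Longrightarrow> (y - a) * (3 * y - 2 + a) < 0"
    using assms a by (auto intro: mult_nonpos_nonneg mult_neg_pos)
  moreover have "reply1 a r y * (2 * y + r - 1) \<ge> 0"
    "y = a \<Longrightarrow> reply1 a r y * (2 * y + r - 1) > 0"
    using reply1_pos[of y] assms a r by (auto intro!: mult_nonneg_nonneg mult_pos_pos)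
  ultimately show ?thesis using assms by (cases "y = a") auto
qed

text \<open>A nonzero \<open>foc2\<close> leaves firm 2 a profitable price change, feasible because
  \<open>foc2\<close> is positive at 0 and negative on \<open>[1/2, a]\<close>. Conversely, the
  remainder in \<open>profit2_expand\<close> is nonpositive.\<close>

lemma is_equilibrium_iff:
  "is_equilibrium a r (p1, p2) \<longleftrightarrow>
     0 < p2 \<and> p2 < 1/2 \<and> p1 = reply1 a r p2 \<and> foc2 a r p2 = 0"
proof
  assume "is_equilibrium a r (p1, p2)"
  then have p1: "0 \<le> p1" and opt1: "\<And>q. 0 \<le> q \<Longrightarrow> profit1 a r q p2 \<le> profit1 a r p1 p2"
    and p2: "0 \<le> p2" "p2 \<le> a"
    and opt2: "\<And>q. 0 \<le> q \<Longrightarrow> q \<le> a \<Longrightarrow> profit2 a r p1 q \<le> profit2 a r p1 p2"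
    unfolding is_equilibrium_def is_arg_max_def by (auto simp: not_less)
  have "(reply1 a r p2 - p1)^2 \<le> 0"
    using opt1[of "reply1 a r p2"] reply1_pos[OF p2] profit1_reply1[of a r p2 p1] by linarith
  then have reply: "p1 = reply1 a r p2" by simp
  have deriv: "((\<lambda>q. profit2 a r p1 q) has_real_derivative foc2 a r p2) (at p2)"
    using profit2_deriv[of a r p1 p2] unfolding foc2_def reply by simp
  have "\<not> 0 < foc2 a r p2"
  proof
    assume pos: "0 < foc2 a r p2"
    then have "p2 < a" using foc2_neg[of p2] a p2 by fastforce
    obtain d where d: "0 < d" "\<And>h. 0 < h \<Longrightarrow> h < d \<Longrightarrow> profit2 a r p1 p2 < profit2 a r p1 (p2 + h)"
      using DERIV_pos_inc_right[OF deriv pos] by blast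
    define h where "h = min (d / 2) (a - p2)"
    have "0 < h" "h < d" "p2 + h \<le> a" using d \<open>p2 < a\<close> by (auto simp: h_def)
    then show False using d(2)[of h] opt2[of "p2 + h"] p2 by auto
  qed
  moreover have "\<not> foc2 a r p2 < 0"
  proof
    assume neg: "foc2 a r p2 < 0"
    then have "0 < p2" using foc2_zero_pos p2 by (cases "p2 = 0") auto
    obtain d where d: "0 < d" "\<And>h. 0 < h \<Longrightarrow> h < d \<Longrightarrow> profit2 a r p1 p2 < profit2 a r p1 (p2 - h)"
      using DERIV_neg_dec_left[OF deriv neg] by blast
    define h where "h = min (d / 2) p2"
    have "0 < h" "h < d" "0 \<le> p2 - h" using d \<open>0 < p2\<close> by (auto simp: h_def)
    then show False using d(2)[of h] opt2[of "p2 - h"] p2 by auto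
  qed
  ultimately have "foc2 a r p2 = 0" by linarith
  moreover from this have "0 < p2" "p2 < 1/2"
    using foc2_zero_pos foc2_neg[of p2] p2 by (cases "p2 = 0"; force)+
  ultimately show "0 < p2 \<and> p2 < 1/2 \<and> p1 = reply1 a r p2 \<and> foc2 a r p2 = 0"
    using reply by blast
next
  assume *: "0 < p2 \<and> p2 < 1/2 \<and> p1 = reply1 a r p2 \<and> foc2 a r p2 = 0"
  have p1: "0 < p1" using reply1_pos[of p2] * a by auto
  have "profit1 a r q p2 \<le> profit1 a r p1 p2" for q
    using profit1_reply1[of a r p2 q] * by (metis diff_ge_0_iff_ge zero_le_power2)
  moreover have "profit2 a r p1 q \<le> profit2 a r p1 p2" if "q \<le> a" for q
  proof -
    \<comment> \<open>The last factor is negative by \<open>p2 < 1/2\<close>, \<open>p1 > 0\<close>,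
      \<open>q \<le> a\<close> and \<open>r \<le> 1 - a\<close>.\<close>
    have "(q - p2)^2 / 2 * (2 * p2 + q - 2 * p1 - 2 + r) \<le> 0"
      using * that p1 a r by (intro mult_nonneg_nonpos) auto
    then show ?thesis using profit2_expand[of a r p1 q p2] * unfolding foc2_def by auto
  qed
  ultimately show "is_equilibrium a r (p1, p2)"
    using * p1 a unfolding is_equilibrium_def is_arg_max_def by (auto simp: not_less)
qed

lemma foc2_root_unique:
  assumes "0 < y" "y < 1/2" "foc2 a r y = 0" "0 < z" "z < 1/2" "foc2 a r z = 0"
  shows "y = z"
  using foc2_diff_price[of a r z y] foc2_drop_gt(2)[of y z] assms by simp

lemma foc2_root_exists: "\<exists>y. 0 < y \<and> y < 1/2 \<and> foc2 a r y = 0"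
proof -
  have "continuous_on {0..1/2} (\<lambda>y. foc2 a r y)"
    unfolding foc2_eq by (intro continuous_intros) auto
  then obtain y where "0 \<le> y" "y \<le> 1/2" "foc2 a r y = 0"
    using IVT2'[of "\<lambda>y. foc2 a r y" "1/2" 0 0] foc2_zero_pos foc2_neg[of "1/2"] a by fastforce
  then show ?thesis
    using foc2_zero_pos foc2_neg[of "1/2"] a
    by (intro exI[of _ y]) (cases "y = 0"; cases "y = 1/2"; force)
qed

lemma equilibrium_prices:
  "0 < price2 a r" "price2 a r < 1/2" "foc2 a r (price2 a r) = 0"
  "price1 a r = reply1 a r (price2 a r)"
proof -
  obtain y where y: "0 < y" "y < 1/2" "foc2 a r y = 0" using foc2_root_exists by blast
  have "equilibrium a r = (reply1 a r y, y)"
    unfolding equilibrium_def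
  proof (rule the_equality)
    show "is_equilibrium a r (reply1 a r y, y)" using y by (simp add: is_equilibrium_iff)
  next
    fix p assume "is_equilibrium a r p"
    then show "p = (reply1 a r y, y)"
      using foc2_root_unique[of "snd p" y] y by (cases p) (auto simp: is_equilibrium_iff)
  qed
  then show "0 < price2 a r" "price2 a r < 1/2" "foc2 a r (price2 a r) = 0"
    "price1 a r = reply1 a r (price2 a r)"
    using y by (auto simp: price1_def price2_def)
qed

text \<open>\<open>foc2\<close> crosses zero downwards, so locating the price only takes the sign of
  the cubic at a test value.\<close>

lemma price2_less_iff:
  assumes "0 \<le> z" "z \<le> 1/2"
  shows "z < price2 a r \<longleftrightarrow> foc2 a r z > 0"
proof -
  have "foc2 a r z = (price2 a r - z) * foc2_drop a r (price2 a r) z"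
    using foc2_diff_price[of a r z "price2 a r"] equilibrium_prices by simp
  moreover have "foc2_drop a r (price2 a r) z > 0"
    using foc2_drop_gt(2) equilibrium_prices assms by simp
  ultimately show ?thesis by (simp add: zero_less_mult_iff)
qed

section \<open>Sign of the \<open>r\<close>-derivative at the equilibrium price\<close>

lemma foc2_dr_nonpos:
  assumes "r \<le> (1 - a)^2 + 1/50"
  shows "foc2_dr a r (price2 a r) \<le> 0"
proof -
  text \<open>\<open>z\<close> is a linear lower approximation, valid for \<open>(1 - a)^2 \<ge> r - 1/50\<close>, to the price at which
    \<open>foc2_dr\<close> vanishes.\<close>
  define z where "z = (23 - 22 * r) / 50"
  have r': "r \<le> 27/100" using assms cost_sq(2) by linarith
  have z: "0 \<le> z" "z \<le> 1/2" using r r' by (auto simp: z_def)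
  have rr: "r^2 \<le> 27/100 * r" using r r' mult_right_mono[of r "27/100" r] by (simp add: power2_eq_square)
  \<comment> \<open>\<open>(1 - a)^2\<close> has a negative coefficient in \<open>foc2\<close>, so
    its lower bound \<open>r - 1/50\<close> eliminates \<open>a\<close>.\<close>
  have "(1 - a)^2 * (z / 2 + 1/4 + r / 4) \<ge> (r - 1/50) * (z / 2 + 1/4 + r / 4)"
    using assms z r by (intro mult_right_mono) auto
  then have "foc2 a r z \<le> z^3 / 2 + z^2 / 4 - 2 * z + 3/4 + r * (z^2 / 4 + 3/2 * z - 3/4) + r^2 / 2
      - (r - 1/50) * (z / 2 + 1/4 + r / 4)"
    unfolding foc2_eq by (simp add: algebra_simps)
  also have "\<dots> \<le> 0"
  proof -
    have "r^3 \<le> r^2" using r r' by (intro power_decreasing) auto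
    then have "- 14708/250000 + 38161/250000 * r - 27304/250000 * r^2 + 1452/250000 * r^3 \<le> 0"
      using r r' zero_le_power2[of r] by linarith
    then show ?thesis
      unfolding z_def by (simp add: field_simps power2_eq_square power3_eq_cube)
  qed
  finally have "price2 a r \<le> z" using price2_less_iff[OF z] by linarith
  then have "foc2_dr a r (price2 a r) \<le> foc2_dr a r z"
    using equilibrium_prices(1) power_mono[of "price2 a r" z 2] unfolding foc2_dr_def by argo
  also have "\<dots> \<le> z^2 / 4 + 3/2 * z - 3/4 + 3/4 * r + 1/200"
    using assms unfolding foc2_dr_def by argo
  also have "\<dots> \<le> 0"
    using r rr r' unfolding z_def by (simp add: field_simps power2_eq_square)
  finally show ?thesis .
qed

text \<open>At \<open>p2 = (1 - r) / 2\<close> the coefficient of \<open>p1\<close> in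
  \<open>marginal2\<close> vanishes, and \<open>foc2\<close> collapses to
  \<open>(8 - (3 - r)^2 - 4 * (1 - a)^2) / 8\<close>, which is positive beyond
  \<open>rbar a\<close>.\<close>

lemma foc2_dr_pos:
  assumes "rbar a < r"
  shows "foc2_dr a r (price2 a r) > 0"
proof -
  define m where "m = (1 - r) / 2"
  have m: "0 \<le> m" "m \<le> 1/2" using r a by (auto simp: m_def)
  have "3 - r < 2 * sqrt (- (a^2) + 2 * a + 1)" using assms by (simp add: rbar_def)
  then have "(3 - r)^2 < (2 * sqrt (- (a^2) + 2 * a + 1))^2"
    using r a by (intro power_strict_mono) auto
  also have "\<dots> = 4 * (- (a^2) + 2 * a + 1)"
    using cost_sq(2) by (simp add: power_mult_distrib power2_eq_square algebra_simps)
  finally have "foc2 a r m > 0"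
    unfolding foc2_eq m_def by (simp add: field_simps power2_eq_square power3_eq_cube)
  then have "m < price2 a r" using price2_less_iff[OF m] by simp
  then have "foc2_dr a r (price2 a r) > foc2_dr a r m"
    using m power_strict_mono[of m "price2 a r" 2] unfolding foc2_dr_def by simp
  moreover have "foc2_dr a r m = ((1 + r)^2 - 4 * (1 - a)^2) / 16"
    unfolding foc2_dr_def m_def by (simp add: field_simps power2_eq_square)
  moreover have "(1 + r)^2 \<ge> 1" using r by simp
  ultimately show ?thesis using cost_sq(2) by simp
qed

end

section \<open>Comparison of two return costs\<close>

context
  fixes a r t :: real
  assumes a: "1/2 < a" "a < 1" and rt: "0 \<le> r" "r < t" "t \<le> 1 - a"
begin

text \<open>The two orders of changing price and cost: one evaluates the \<open>r\<close>-derivative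
  at the old price, the other at the new one.\<close>

lemma price2_diff:
  "(price2 a t - price2 a r) * foc2_drop a t (price2 a r) (price2 a t)
     = (t - r) * foc2_dr a ((r + t) / 2) (price2 a r)"
  "(price2 a t - price2 a r) * foc2_drop a r (price2 a r) (price2 a t)
     = (t - r) * foc2_dr a ((r + t) / 2) (price2 a t)"
proof -
  have "foc2 a r (price2 a r) = 0" "foc2 a t (price2 a t) = 0"
    using equilibrium_prices(3) a rt by auto
  then show "(price2 a t - price2 a r) * foc2_drop a t (price2 a r) (price2 a t)
      = (t - r) * foc2_dr a ((r + t) / 2) (price2 a r)"
    "(price2 a t - price2 a r) * foc2_drop a r (price2 a r) (price2 a t)
      = (t - r) * foc2_dr a ((r + t) / 2) (price2 a t)"
    using foc2_diff_price[of a t "price2 a t" "price2 a r"] foc2_diff_cost[of a t "price2 a r" r]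
      foc2_diff_price[of a r "price2 a t" "price2 a r"] foc2_diff_cost[of a t "price2 a t" r]
    by (simp_all only: mult_minus_left)
qed

lemma price2_increasing_if:
  assumes "foc2_dr a r (price2 a r) > 0"
  shows "price2 a r < price2 a t"
proof -
  \<comment> \<open>\<open>foc2_dr\<close> increases in \<open>r\<close>, so its sign passes from
    \<open>r\<close> to the midpoint.\<close>
  have "foc2_dr a ((r + t) / 2) (price2 a r) > 0" using assms rt unfolding foc2_dr_def by argo
  moreover have "foc2_drop a t (price2 a r) (price2 a t) > 0"
    using foc2_drop_gt(2) equilibrium_prices[of a r] equilibrium_prices[of a t] a rt by simp
  ultimately show ?thesis using price2_diff(1) rt by (smt (verit) mult_pos_pos mult_nonpos_nonneg)
qed

lemma price2_decreasing_if:
  assumes "foc2_dr a t (price2 a t) \<le> 0"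
  shows "price2 a t < price2 a r"
proof -
  have "foc2_dr a ((r + t) / 2) (price2 a t) < 0" using assms rt unfolding foc2_dr_def by argo
  moreover have "foc2_drop a r (price2 a r) (price2 a t) > 0"
    using foc2_drop_gt(2) equilibrium_prices[of a r] equilibrium_prices[of a t] a rt by simp
  ultimately show ?thesis using price2_diff(2) rt by (smt (verit) mult_pos_neg mult_nonneg_nonneg)
qed

text \<open>The ratio of price change to cost change is \<open>T / S\<close>, and
  \<open>T < S\<close>.\<close>

lemma price2_increase_less: "price2 a t - price2 a r < t - r"
proof -
  define S where "S = foc2_drop a t (price2 a r) (price2 a t)"
  define T where "T = foc2_dr a ((r + t) / 2) (price2 a r)"
  note y = equilibrium_prices[of a r] and z = equilibrium_prices[of a t]
  have S: "S \<ge> 11/8 + (1 - a)^2 / 2 - 7/4 * t" "S > 0"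
    unfolding S_def using foc2_drop_gt[of a t] y z a rt by simp_all
  have "(price2 a r)^2 \<le> 1/4"
    using y a rt product_bounds_half[of "price2 a r" "price2 a r"] by (simp add: power2_eq_square)
  then have "T \<le> 1/16 - (1 - a)^2 / 4 + t"
    unfolding T_def foc2_dr_def using y a rt by argo
  \<comment> \<open>\<open>(1 - a)^2 \<ge> t^2\<close>, and \<open>t - 1/4\<close> is the tangent of
    \<open>t^2\<close> at \<open>1/2\<close>.\<close>
  moreover have "(1 - a)^2 \<ge> t - 1/4"
    using cost_sq(1)[of a t] a rt zero_le_power2[of "t - 1/2"]
    by (simp add: power2_eq_square algebra_simps)
  ultimately have "T < S" using S(1) a rt by linarith
  then have "(price2 a t - price2 a r) * S < (t - r) * S"
    using price2_diff(1) rt unfolding S_def[symmetric] T_def[symmetric] by simp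
  then show ?thesis using S(2) by simp
qed

text \<open>The reply falls directly by \<open>(t - r) / 2\<close>; the indirect rise through
  \<open>p2\<close> has a factor below 1 and cannot offset it.\<close>

lemma price1_decreasing: "price1 a t < price1 a r"
proof -
  define y where "y = price2 a r"
  define z where "z = price2 a t"
  note yp = equilibrium_prices[of a r] and zp = equilibrium_prices[of a t]
  have yz: "0 < y" "y < 1/2" "0 < z" "z < 1/2" unfolding y_def z_def using yp zp a rt by auto
  have "(z - y) * (1 - (y + z) / 2) < t - r"
  proof (cases "z \<le> y")
    case True
    then have "(z - y) * (1 - (y + z) / 2) \<le> 0" using yz by (intro mult_nonpos_nonneg) auto
    then show ?thesis using rt by linarith
  next
    case False
    then have "(z - y) * (1 - (y + z) / 2) \<le> (z - y) * 1" using yz by (intro mult_left_mono) auto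
    then show ?thesis using price2_increase_less by (simp add: y_def z_def)
  qed
  then have "reply1 a t z < reply1 a r y"
    unfolding reply1_def by (simp add: field_simps power2_eq_square)
  then show ?thesis using yp zp a rt by (simp add: y_def z_def)
qed

end

section \<open>Position of the thresholds and conclusion\<close>

lemma rbar_gt:
  assumes "1/2 < a" "a < 1"
  shows "(1 - a)^2 + 1/50 < rbar a"
proof -
  \<comment> \<open>\<open>rbar a = 3 - 2 * v\<close> and \<open>(1 - a)^2 = 2 - v^2\<close>, so
    their gap is \<open>(v - 1)^2\<close>, which exceeds \<open>1/25\<close>.\<close>
  define v where "v = sqrt (- (a^2) + 2 * a + 1)"
  have q: "- (a^2) + 2 * a + 1 = 2 - (1 - a)^2" by (simp add: power2_eq_square algebra_simps)
  have "(1 - a)^2 < 1/4" using cost_sq(2)[of a 0] assms by simp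
  then have v2: "v^2 = 2 - (1 - a)^2" unfolding v_def q by simp
  have "v > 6/5"
    unfolding v_def q using \<open>(1 - a)^2 < 1/4\<close>
    by (intro real_less_rsqrt) (simp add: power2_eq_square[of "6/5"])
  then have "(v - 1)^2 > (1/5)^2" by (intro power_strict_mono) auto
  then have "v^2 - 2 * v + 1 > 1/25" by (simp add: power2_eq_square algebra_simps)
  then show ?thesis unfolding rbar_def v_def[symmetric] using v2 by linarith
qed

theorem mainTheorem15:
  fixes s a :: real
  assumes "0 < s" and "s < 1/8" and "a = 1 - sqrt (2 * s)"
  shows "(\<exists>rhat. rbar_p a < rhat \<and> rhat < rbar a \<and>
            strict_antimono_on ({0..rhat} \<inter> {0..1 - a}) (price1 a) \<and>
            strict_antimono_on ({0..rhat} \<inter> {0..1 - a}) (price2 a)) \<and>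
         strict_antimono_on {rbar a<..1 - a} (price1 a) \<and>
         strict_mono_on {rbar a<..1 - a} (price2 a)"
proof -
  have "sqrt (2 * s) < sqrt ((1/2)^2)" using assms by (subst real_sqrt_less_iff) (simp add: power2_eq_square)
  then have a: "1/2 < a" "a < 1" using assms by auto
  \<comment> \<open>Costs beyond \<open>rbar a\<close> are thus nonnegative, as the comparison
    lemmas require.\<close>
  have "rbar a > 0" using rbar_gt[OF a] zero_le_power2[of "1 - a"] by linarith
  let ?rhat = "(1 - a)^2 + 1/50"
  have "rbar_p a < ?rhat" by (simp add: rbar_p_def)
  moreover have "strict_antimono_on ({0..?rhat} \<inter> {0..1 - a}) (price1 a)"
    using price1_decreasing[OF a] by (auto intro!: monotone_onI)
  moreover have "strict_antimono_on ({0..?rhat} \<inter> {0..1 - a}) (price2 a)"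
    using price2_decreasing_if[OF a] foc2_dr_nonpos[OF a] by (auto intro!: monotone_onI)
  moreover have "strict_antimono_on {rbar a<..1 - a} (price1 a)"
    using price1_decreasing[OF a] \<open>rbar a > 0\<close> by (auto intro!: monotone_onI)
  moreover have "strict_mono_on {rbar a<..1 - a} (price2 a)"
    using price2_increasing_if[OF a] foc2_dr_pos[OF a] \<open>rbar a > 0\<close> by (auto intro!: monotone_onI)
  ultimately show ?thesis using rbar_gt[OF a] by blast
qed

end
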